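(* A displacement field $\mathbf{u}:\Omega\to\mathbb{R}^3$ is universal for the tetragonal class $\mathbb{D}_4$ of linear strain-gradient elastic solids if and only if it is the superposition (sum) of a homogeneous displacement field and a field of the form $$\bigl(c_1x_2x_3+c_2x_1x_3,\; -c_2x_2x_3+c_3x_1x_3,\; g(x_1,x_2)\bigr),\qquad g(x_1,x_2)=d_1+d_2x_1+d_3x_2+d_4x_1x_2+d_5(x_2^2-x_1^2),$$ for some real constants $c_1,c_2,c_3,d_1,\dots,d_5$.
   Context: $\Omega\subset\mathbb{R}^3$ is a nonempty convex open set with Cartesian coordinates $(x_1,x_2,x_3)$ and orthonormal basis $e_1,e_2,e_3$. Repeated indices are summed over $1,2,3$ and a comma denotes partial differentiation. A displacement field is a smooth map $\mathbf{u}:\Omega\to\mathbb{R}^3$, with strain $e_{lm}=\tfrac12(u_{l,m}+u_{m,l})$. It is homogeneous if $\mathbf{u}(\mathbf{x})=\mathbf{H}\mathbf{x}+\mathbf{b}$ for a constant matrix $\mathbf{H}$ and constant vector $\mathbf{b}$. A strain-gradient material is a triple $(\mathsf{C},\mathsf{M},\mathsf{A})$ of constant real tensors of orders $4,5,6$ with index symmetries $\mathsf{C}_{ijlm}=\mathsf{C}_{jilm}=\mathsf{C}_{lmij}$, $\mathsf{M}_{ijklm}=\mathsf{M}_{jiklm}=\mathsf{M}_{ijlkm}$, $\mathsf{A}_{ijklmn}=\mathsf{A}_{jiklmn}=\mathsf{A}_{lmnijk}$. Its stress and hyper-stress are $\sigma_{ij}=\mathsf{C}_{ijlm}e_{lm}+\mathsf{M}_{ijlmn}e_{lm,n}$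 and $\tau_{ijk}=\mathsf{M}_{lmijk}e_{lm}+\mathsf{A}_{ijklmn}e_{lm,n}$, and the equilibrium equations without body forces are $\sigma_{ij,j}-\tau_{ijk,jk}=0$ in $\Omega$ for $i=1,2,3$. For a subgroup $G\subset \mathrm{O}(3)$, a tensor $T$ of order $p$ is $G$-invariant if $Q_{i_1j_1}\cdots Q_{i_pj_p}T_{j_1\dots j_p}=T_{i_1\dots i_p}$ for all $Q\in G$. $\mathbb{D}_4$ is generated by the rotation by $\pi/2$ about $e_3$ and the rotation by $\pi$ about $e_1$; $\mathbb{Z}_2^c=\{I,-I\}$, and $\mathbb{D}_4\oplus\mathbb{Z}_2^c$ is the group generated by $\mathbb{D}_4$ and $-I$. The tetragonal class $\mathbb{D}_4$ is the set of all materials with $\mathsf{C}$ and $\mathsf{A}$ $\mathbb{D}_4\oplus\mathbb{Z}_2^c$-invariant (6 and 28 independent constants) and $\mathsf{M}$ $\mathbb{D}_4$-invariant (11 independent constants). A displacement field is universal for the class if it satisfies the equilibrium equations for every material in the class. *)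

theory Defs
  imports "HOL-Analysis.Analysis" "HOL-Algebra.Generated_Groups"
begin

text \<open>
  Indices range over the type \<^typ>\<open>3\<close>, whose elements are \<open>1\<close>, \<open>2\<close> and \<open>3\<close> (with \<open>3 = 0\<close>).
  Sums over repeated indices are sums over \<open>UNIV\<close>.
\<close>

definition partial :: "3 \<Rightarrow> (real^3 \<Rightarrow> real) \<Rightarrow> real^3 \<Rightarrow> real" where
  "partial i f x = deriv (\<lambda>t. f (x + t *\<^sub>R axis i 1)) 0"

definition iterated_partial :: "3 list \<Rightarrow> (real^3 \<Rightarrow> real) \<Rightarrow> real^3 \<Rightarrow> real" where
  "iterated_partial is f = foldr partial is f"

text \<open>
  On an open set, a function is \<open>C\<^sup>\<infinity>\<close> iff all its iterated partial derivatives (including the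
  function itself) are Frechet differentiable, which in turn makes them continuous.
\<close>
definition smooth_on :: "(real^3) set \<Rightarrow> (real^3 \<Rightarrow> real) \<Rightarrow> bool" where
  "smooth_on \<Omega> f \<longleftrightarrow> (\<forall>is. \<forall>x\<in>\<Omega>. iterated_partial is f differentiable (at x))"

text \<open>Fields are total functions on \<open>\<real>\<^sup>3\<close>, of which only the values on \<open>\<Omega>\<close> are relevant.\<close>
definition displacement_field :: "(real^3) set \<Rightarrow> (real^3 \<Rightarrow> real^3) \<Rightarrow> bool" where
  "displacement_field \<Omega> u \<longleftrightarrow> (\<forall>i. smooth_on \<Omega> (\<lambda>x. u x $ i))"

definition homogeneous_on :: "(real^3) set \<Rightarrow> (real^3 \<Rightarrow> real^3) \<Rightarrow> bool" where
  "homogeneous_on \<Omega> u \<longleftrightarrow> (\<exists>(H :: real^3^3) b. \<forall>x\<in>\<Omega>. u x = H *v x + b)"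

definition strain :: "(real^3 \<Rightarrow> real^3) \<Rightarrow> 3 \<Rightarrow> 3 \<Rightarrow> real^3 \<Rightarrow> real" where
  "strain u l m x = (partial m (\<lambda>y. u y $ l) x + partial l (\<lambda>y. u y $ m) x) / 2"

type_synonym tensor4 = "3 \<Rightarrow> 3 \<Rightarrow> 3 \<Rightarrow> 3 \<Rightarrow> real"
type_synonym tensor5 = "3 \<Rightarrow> 3 \<Rightarrow> 3 \<Rightarrow> 3 \<Rightarrow> 3 \<Rightarrow> real"
type_synonym tensor6 = "3 \<Rightarrow> 3 \<Rightarrow> 3 \<Rightarrow> 3 \<Rightarrow> 3 \<Rightarrow> 3 \<Rightarrow> real"

type_synonym material = "tensor4 \<times> tensor5 \<times> tensor6"

definition strain_gradient_materials :: "material set" where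
  "strain_gradient_materials = {(C, M, A).
     (\<forall>i j l m. C i j l m = C j i l m \<and> C i j l m = C l m i j) \<and>
     (\<forall>i j k l m. M i j k l m = M j i k l m \<and> M i j k l m = M i j l k m) \<and>
     (\<forall>i j k l m n. A i j k l m n = A j i k l m n \<and> A i j k l m n = A l m n i j k)}"

fun stress :: "material \<Rightarrow> (real^3 \<Rightarrow> real^3) \<Rightarrow> 3 \<Rightarrow> 3 \<Rightarrow> real^3 \<Rightarrow> real" where
  "stress (C, M, A) u i j x =
     (\<Sum>l\<in>UNIV. \<Sum>m\<in>UNIV. C i j l m * strain u l m x) +
     (\<Sum>l\<in>UNIV. \<Sum>m\<in>UNIV. \<Sum>n\<in>UNIV. M i j l m n * partial n (strain u l m) x)"

fun hyper_stress :: "material \<Rightarrow> (real^3 \<Rightarrow> real^3) \<Rightarrow> 3 \<Rightarrow> 3 \<Rightarrow> 3 \<Rightarrow> real^3 \<Rightarrow> real" where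
  "hyper_stress (C, M, A) u i j k x =
     (\<Sum>l\<in>UNIV. \<Sum>m\<in>UNIV. M l m i j k * strain u l m x) +
     (\<Sum>l\<in>UNIV. \<Sum>m\<in>UNIV. \<Sum>n\<in>UNIV. A i j k l m n * partial n (strain u l m) x)"

definition equilibrium :: "(real^3) set \<Rightarrow> material \<Rightarrow> (real^3 \<Rightarrow> real^3) \<Rightarrow> bool" where
  "equilibrium \<Omega> P u \<longleftrightarrow> (\<forall>x\<in>\<Omega>. \<forall>i.
     (\<Sum>j\<in>UNIV. partial j (stress P u i j) x) -
     (\<Sum>j\<in>UNIV. \<Sum>k\<in>UNIV. partial k (partial j (hyper_stress P u i j k)) x) = 0)"

definition universal_for :: "(real^3) set \<Rightarrow> material set \<Rightarrow> (real^3 \<Rightarrow> real^3) \<Rightarrow> bool" where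
  "universal_for \<Omega> class u \<longleftrightarrow> (\<forall>P\<in>class. equilibrium \<Omega> P u)"

definition invariant4 :: "(real^3^3) set \<Rightarrow> tensor4 \<Rightarrow> bool" where
  "invariant4 G T \<longleftrightarrow> (\<forall>Q\<in>G. \<forall>i j k l.
     (\<Sum>a\<in>UNIV. \<Sum>b\<in>UNIV. \<Sum>c\<in>UNIV. \<Sum>d\<in>UNIV.
        Q $ i $ a * Q $ j $ b * Q $ k $ c * Q $ l $ d * T a b c d) = T i j k l)"

definition invariant5 :: "(real^3^3) set \<Rightarrow> tensor5 \<Rightarrow> bool" where
  "invariant5 G T \<longleftrightarrow> (\<forall>Q\<in>G. \<forall>i j k l m.
     (\<Sum>a\<in>UNIV. \<Sum>b\<in>UNIV. \<Sum>c\<in>UNIV. \<Sum>d\<in>UNIV. \<Sum>e\<in>UNIV.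
        Q $ i $ a * Q $ j $ b * Q $ k $ c * Q $ l $ d * Q $ m $ e * T a b c d e) = T i j k l m)"

definition invariant6 :: "(real^3^3) set \<Rightarrow> tensor6 \<Rightarrow> bool" where
  "invariant6 G T \<longleftrightarrow> (\<forall>Q\<in>G. \<forall>i j k l m n.
     (\<Sum>a\<in>UNIV. \<Sum>b\<in>UNIV. \<Sum>c\<in>UNIV. \<Sum>d\<in>UNIV. \<Sum>e\<in>UNIV. \<Sum>f\<in>UNIV.
        Q $ i $ a * Q $ j $ b * Q $ k $ c * Q $ l $ d * Q $ m $ e * Q $ n $ f * T a b c d e f)
     = T i j k l m n)"

definition O3 :: "(real^3^3) monoid" where
  "O3 = \<lparr>carrier = {Q. orthogonal_matrix Q}, mult = (**), one = mat 1\<rparr>"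

definition rotation_e1 :: "real \<Rightarrow> real^3^3" where
  "rotation_e1 \<theta> = vector [vector [1, 0, 0],
                           vector [0, cos \<theta>, - sin \<theta>],
                           vector [0, sin \<theta>, cos \<theta>]]"

definition rotation_e3 :: "real \<Rightarrow> real^3^3" where
  "rotation_e3 \<theta> = vector [vector [cos \<theta>, - sin \<theta>, 0],
                           vector [sin \<theta>, cos \<theta>, 0],
                           vector [0, 0, 1]]"

definition D4 :: "(real^3^3) set" where
  "D4 = generate O3 {rotation_e3 (pi / 2), rotation_e1 pi}"

definition D4_Z2c :: "(real^3^3) set" where
  "D4_Z2c = generate O3 (insert (- mat 1) D4)"

definition tetragonal_D4_class :: "material set" where
  "tetragonal_D4_class = {(C, M, A) \<in> strain_gradient_materials.
     invariant4 D4_Z2c C \<and> invariant5 D4 M \<and> invariant6 D4_Z2c A}"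

end

theory Submission
  imports Defs
begin

text \<open>
  The equilibrium equations are linear in the material: \<open>C\<close> multiplies second partial derivatives
  of the displacement, \<open>M\<close> third ones and \<open>A\<close> fourth ones. Testing with the six elementary
  tensors \<open>C\<close> gives linear relations between the second derivatives. They force all third
  derivatives to vanish except those of \<open>g = u\<^sub>3\<close>, which is harmonic in \<open>(x\<^sub>1, x\<^sub>2)\<close>; a single
  tensor \<open>M\<close> then gives \<open>g\<^sub>1\<^sub>1\<^sub>1 = g\<^sub>1\<^sub>2\<^sub>2\<close> and \<open>g\<^sub>1\<^sub>1\<^sub>2 = g\<^sub>2\<^sub>2\<^sub>2\<close>, whence all third derivatives are zero
  and the displacement is quadratic. Conversely, \<open>M\<close> and \<open>A\<close> do not see a quadratic displacement,
  and a parity argument on the indices of an invariant \<open>C\<close> leaves only the relations found above.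
\<close>

section \<open>Calculus of partial derivatives\<close>

lemma has_derivative_partial:
  assumes "(f has_derivative f') (at x)"
  shows "partial i f x = f' (axis i 1)"
proof -
  have "((\<lambda>t. f (x + t *\<^sub>R axis i 1)) has_derivative (\<lambda>t. f' (t *\<^sub>R axis i 1))) (at 0)"
    by (rule has_derivative_compose[of "\<lambda>t. x + t *\<^sub>R axis i 1" _ 0 UNIV f f'])
      (auto intro!: derivative_eq_intros assms)
  moreover have "f' (t *\<^sub>R axis i 1) = t * f' (axis i 1)" for t
    using linear_scale[OF has_derivative_linear[OF assms]] by simp
  ultimately show ?thesis
    unfolding partial_def
    by (intro DERIV_imp_deriv) (simp add: has_field_derivative_def mult_commute_abs)
qed

lemma DERIV_partial:
  assumes "f differentiable (at (x + t *\<^sub>R axis i 1))"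
  shows "((\<lambda>t. f (x + t *\<^sub>R axis i 1)) has_real_derivative partial i f (x + t *\<^sub>R axis i 1)) (at t)"
proof -
  obtain f' where f': "(f has_derivative f') (at (x + t *\<^sub>R axis i 1))"
    using assms unfolding differentiable_def by blast
  have "((\<lambda>t. f (x + t *\<^sub>R axis i 1)) has_derivative (\<lambda>t. f' (t *\<^sub>R axis i 1))) (at t)"
    by (rule has_derivative_compose[of "\<lambda>t. x + t *\<^sub>R axis i 1" _ t UNIV f f'])
      (auto intro!: derivative_eq_intros f')
  moreover have "f' (t *\<^sub>R axis i 1) = t * f' (axis i 1)" for t
    using linear_scale[OF has_derivative_linear[OF f']] by simp
  ultimately show ?thesis
    by (simp add: has_derivative_partial[OF f'] has_field_derivative_def mult_commute_abs)
qed

text \<open>Differentiability alone names no derivative. This supplies the explicit one, with the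
  gradient as coefficients, so that the calculus of \<open>has_derivative\<close> yields rules for
  \<open>partial\<close>.\<close>

lemma has_derivative_via_partial:
  assumes "f differentiable (at x)"
  shows "(f has_derivative (\<lambda>h. \<Sum>i\<in>UNIV. partial i f x * h $ i)) (at x)"
proof -
  obtain f' where f': "(f has_derivative f') (at x)"
    using assms unfolding differentiable_def by blast
  have "f' h = (\<Sum>i\<in>UNIV. partial i f x * h $ i)" for h
  proof -
    have "f' h = f' (\<Sum>i\<in>UNIV. (h $ i) *\<^sub>R axis i 1)"
      by (simp add: basis_expansion flip: scalar_mult_eq_scaleR)
    also have "\<dots> = (\<Sum>i\<in>UNIV. h $ i * f' (axis i 1))"
      using has_derivative_linear[OF f'] by (simp add: linear_sum linear_scale)
    finally show ?thesis by (simp add: has_derivative_partial[OF f'] mult.commute)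
  qed
  then have "f' = (\<lambda>h. \<Sum>i\<in>UNIV. partial i f x * h $ i)" by blast
  with f' show ?thesis by simp
qed

text \<open>A partial derivative sees only values near \<open>x\<close> on a line, and openness
  keeps that piece of the line inside \<open>\<Omega>\<close>. Fields are controlled on
  \<open>\<Omega>\<close> only, so identities that are to be differentiated again pass through this
  lemma.\<close>

lemma partial_cong:
  assumes "open \<Omega>" "x \<in> \<Omega>" "\<And>y. y \<in> \<Omega> \<Longrightarrow> f y = g y"
  shows "partial i f x = partial i g x"
proof -
  have "continuous_on UNIV (\<lambda>t. x + t *\<^sub>R axis i 1)"
    by (intro continuous_intros)
  then have "open ((\<lambda>t. x + t *\<^sub>R axis i 1) -` \<Omega>)"
    using assms(1) by (metis continuous_on_open_vimage open_UNIV inf_top_right)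
  then have "eventually (\<lambda>t. t \<in> (\<lambda>t. x + t *\<^sub>R axis i 1) -` \<Omega>) (nhds 0)"
    using assms(2) by (intro eventually_nhds_in_open) auto
  then show ?thesis
    unfolding partial_def by (intro deriv_cong_ev) (auto elim!: eventually_mono simp: assms(3))
qed

lemma partial_add:
  "f differentiable (at x) \<Longrightarrow> g differentiable (at x) \<Longrightarrow>
    partial i (\<lambda>y. f y + g y) x = partial i f x + partial i g x"
  using has_derivative_partial[OF has_derivative_add[OF has_derivative_via_partial has_derivative_via_partial, of f x g], of i]
  by (simp add: axis_def if_distrib cong: if_cong)

lemma partial_cmult:
  "f differentiable (at x) \<Longrightarrow> partial i (\<lambda>y. c * f y) x = c * partial i f x"
  using has_derivative_partial[OF has_derivative_mult_right[OF has_derivative_via_partial], of f x i c]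
  by (simp add: axis_def if_distrib cong: if_cong)

lemma partial_const [simp]: "partial i (\<lambda>y. c) x = 0"
  by (simp add: partial_def)

lemma iterated_partial_Nil [simp]: "iterated_partial [] f = f"
  and iterated_partial_Cons [simp]: "iterated_partial (i # is) f = partial i (iterated_partial is f)"
  by (simp_all add: iterated_partial_def)

section \<open>Smoothness under linear operations\<close>

lemma smooth_on_differentiable: "smooth_on \<Omega> f \<Longrightarrow> x \<in> \<Omega> \<Longrightarrow> f differentiable (at x)"
  unfolding smooth_on_def by (metis iterated_partial_Nil)

lemma smooth_on_partial: "smooth_on \<Omega> f \<Longrightarrow> smooth_on \<Omega> (partial i f)"
proof -
  \<comment> \<open>\<open>foldr\<close> applies the last entry of the list first, so the inner
    derivative is appended at the end.\<close>
  have "iterated_partial is (partial i f) = iterated_partial (is @ [i]) f" for "is"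
    by (simp add: iterated_partial_def)
  then show "smooth_on \<Omega> f \<Longrightarrow> smooth_on \<Omega> (partial i f)"
    by (simp add: smooth_on_def)
qed

lemma differentiable_cong_open:
  fixes f :: "'a::real_normed_vector \<Rightarrow> 'b::real_normed_vector"
  assumes "open S" "x \<in> S" "\<And>y. y \<in> S \<Longrightarrow> f y = g y" "g differentiable (at x)"
  shows "f differentiable (at x)"
  using assms unfolding differentiable_def
  by (metis has_derivative_transform_within_open)

lemma smooth_on_const [simp]: "smooth_on \<Omega> (\<lambda>x. c)"
proof -
  have "\<exists>d. iterated_partial is (\<lambda>x. c) = (\<lambda>x. d)" for "is"
  proof (induction "is")
    case (Cons i "is")
    then obtain d where "iterated_partial is (\<lambda>x. c) = (\<lambda>x. d)" by blast
    then have "iterated_partial (i # is) (\<lambda>x. c) = (\<lambda>x. 0)" by (intro ext) (simp only: iterated_partial_Cons partial_const)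
    then show ?case by blast
  qed auto
  then show ?thesis
    unfolding smooth_on_def by (metis differentiable_const)
qed

lemma smooth_on_add:
  assumes "open \<Omega>" "smooth_on \<Omega> f" "smooth_on \<Omega> g"
  shows "smooth_on \<Omega> (\<lambda>x. f x + g x)"
proof -
  have D: "iterated_partial is f differentiable (at x)" "iterated_partial is g differentiable (at x)"
    if "x \<in> \<Omega>" for "is" x
    using assms that by (auto simp: smooth_on_def)
  \<comment> \<open>Additivity is available only on \<open>\<Omega>\<close>, where differentiability
    is known; \<open>partial_cong\<close> carries it through each induction step.\<close>
  have *: "iterated_partial is (\<lambda>x. f x + g x) x = iterated_partial is f x + iterated_partial is g x"
    if "x \<in> \<Omega>" for "is" x
    using that
  proof (induction "is" arbitrary: x)
    case (Cons i "is")
    then show ?case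
      using partial_cong[OF assms(1) Cons.prems Cons.IH] by (simp add: partial_add D)
  qed simp
  show ?thesis
    unfolding smooth_on_def
    by (intro allI ballI differentiable_cong_open[OF assms(1) _ *] differentiable_add D)
qed

lemma smooth_on_cmult:
  assumes "open \<Omega>" "smooth_on \<Omega> f"
  shows "smooth_on \<Omega> (\<lambda>x. c * f x)"
proof -
  have D: "iterated_partial is f differentiable (at x)" if "x \<in> \<Omega>" for "is" x
    using assms that by (auto simp: smooth_on_def)
  have *: "iterated_partial is (\<lambda>x. c * f x) x = c * iterated_partial is f x"
    if "x \<in> \<Omega>" for "is" x
    using that
  proof (induction "is" arbitrary: x)
    case (Cons i "is")
    then show ?case
      using partial_cong[OF assms(1) Cons.prems Cons.IH] by (simp add: partial_cmult D)
  qed simp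
  show ?thesis
    unfolding smooth_on_def
    by (intro allI ballI differentiable_cong_open[OF assms(1) _ *] differentiable_mult differentiable_const D)
qed

lemma smooth_on_sum:
  assumes "open \<Omega>" "\<And>k. k \<in> K \<Longrightarrow> smooth_on \<Omega> (f k)"
  shows "smooth_on \<Omega> (\<lambda>x. \<Sum>k\<in>K. f k x)"
  using assms(2) by (induction K rule: infinite_finite_induct) (auto intro: smooth_on_add[OF assms(1)])

lemma partial_sum:
  assumes "open \<Omega>" "x \<in> \<Omega>" "\<And>k. k \<in> K \<Longrightarrow> smooth_on \<Omega> (f k)"
  shows "partial i (\<lambda>x. \<Sum>k\<in>K. f k x) x = (\<Sum>k\<in>K. partial i (f k) x)"
  using assms(3)
proof (induction K rule: infinite_finite_induct)
  case (insert k K)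
  have "(\<lambda>x. \<Sum>k\<in>K. f k x) differentiable (at x)"
    by (rule smooth_on_differentiable[OF smooth_on_sum]) (use assms insert in auto)
  moreover have "f k differentiable (at x)"
    using insert assms smooth_on_differentiable by blast
  ultimately show ?case
    using insert by (simp add: partial_add)
qed auto

section \<open>Symmetry of second partial derivatives\<close>

lemma second_difference:
  assumes "h > 0" "smooth_on \<Omega> f"
    and "\<And>s t. 0 \<le> s \<Longrightarrow> s \<le> h \<Longrightarrow> 0 \<le> t \<Longrightarrow> t \<le> h \<Longrightarrow> x + s *\<^sub>R axis i 1 + t *\<^sub>R axis j 1 \<in> \<Omega>"
  shows "\<exists>s t. 0 < s \<and> s < h \<and> 0 < t \<and> t < h \<and>
    f (x + h *\<^sub>R axis i 1 + h *\<^sub>R axis j 1) - f (x + h *\<^sub>R axis i 1) - f (x + h *\<^sub>R axis j 1) + f x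
      = h * h * partial j (partial i f) (x + s *\<^sub>R axis i 1 + t *\<^sub>R axis j 1)"
proof -
  let ?e = "axis i 1 :: real^3" and ?d = "axis j 1 :: real^3"
  \<comment> \<open>The increment in direction \<open>j\<close> as a function of the step in
    direction \<open>i\<close>. The mean value theorem for \<open>\<phi>\<close>, and then for
    \<open>partial i f\<close> along direction \<open>j\<close>, turns the second difference into a
    mixed derivative.\<close>
  define \<phi> where "\<phi> s = f (x + h *\<^sub>R ?d + s *\<^sub>R ?e) - f (x + s *\<^sub>R ?e)" for s
  have mem: "x + s *\<^sub>R ?e + t *\<^sub>R ?d \<in> \<Omega>" "x + t *\<^sub>R ?d + s *\<^sub>R ?e \<in> \<Omega>"
    if "0 \<le> s" "s \<le> h" "0 \<le> t" "t \<le> h" for s t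
    using assms(3)[OF that] by (simp_all add: add.commute add.left_commute)
  have mem0: "x + s *\<^sub>R ?e \<in> \<Omega>" if "0 \<le> s" "s \<le> h" for s
    using mem(1)[OF that, of 0] assms(1) by simp
  have "(\<phi> has_real_derivative
      partial i f (x + h *\<^sub>R ?d + s *\<^sub>R ?e) - partial i f (x + s *\<^sub>R ?e)) (at s)"
    if "0 \<le> s" "s \<le> h" for s
    unfolding \<phi>_def
    by (intro DERIV_diff DERIV_partial smooth_on_differentiable[OF assms(2)] mem mem0)
      (use that assms(1) in auto)
  from MVT2[OF assms(1) this] obtain s where s: "0 < s" "s < h"
    "\<phi> h - \<phi> 0 = h * (partial i f (x + h *\<^sub>R ?d + s *\<^sub>R ?e) - partial i f (x + s *\<^sub>R ?e))"
    by auto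
  have "((\<lambda>t. partial i f (x + s *\<^sub>R ?e + t *\<^sub>R ?d)) has_real_derivative
      partial j (partial i f) (x + s *\<^sub>R ?e + t *\<^sub>R ?d)) (at t)"
    if "0 \<le> t" "t \<le> h" for t
    by (intro DERIV_partial smooth_on_differentiable[OF smooth_on_partial[OF assms(2)]] mem)
      (use that s in auto)
  from MVT2[OF assms(1) this] obtain t where t: "0 < t" "t < h"
    "partial i f (x + s *\<^sub>R ?e + h *\<^sub>R ?d) - partial i f (x + s *\<^sub>R ?e)
      = h * partial j (partial i f) (x + s *\<^sub>R ?e + t *\<^sub>R ?d)"
    by auto
  have "x + h *\<^sub>R ?d + s *\<^sub>R ?e = x + s *\<^sub>R ?e + h *\<^sub>R ?d"
    by (simp add: add.commute add.left_commute)
  then have "\<phi> h - \<phi> 0 = h * h * partial j (partial i f) (x + s *\<^sub>R ?e + t *\<^sub>R ?d)"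
    using s(3) t(3) by (simp only: mult.assoc)
  moreover have "\<phi> h - \<phi> 0 = f (x + h *\<^sub>R ?e + h *\<^sub>R ?d) - f (x + h *\<^sub>R ?e) - f (x + h *\<^sub>R ?d) + f x"
    by (simp add: \<phi>_def add.commute add.left_commute)
  ultimately show ?thesis
    using s t by auto
qed

text \<open>The second difference is the same for both orders of \<open>i\<close> and
  \<open>j\<close>, so the two mixed derivatives take a common value at points arbitrarily close to
  \<open>x\<close>; their continuity at \<open>x\<close> leaves no room for a gap.\<close>

lemma partial_commute:
  assumes "open \<Omega>" "smooth_on \<Omega> f" "x \<in> \<Omega>"
  shows "partial i (partial j f) x = partial j (partial i f) x"
proof (rule ccontr)
  let ?e = "\<lambda>i. axis i 1 :: real^3"
  let ?F = "partial i (partial j f)" and ?G = "partial j (partial i f)"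
  assume ne: "?F x \<noteq> ?G x"
  \<comment> \<open>Half the gap: two errors below \<open>\<epsilon>\<close> cannot bridge
    it.\<close>
  define \<epsilon> where "\<epsilon> = \<bar>?F x - ?G x\<bar> / 2"
  have "\<epsilon> > 0" using ne by (simp add: \<epsilon>_def)
  have cont: "isCont ?F x" "isCont ?G x"
    by (auto intro!: differentiable_imp_continuous_within smooth_on_differentiable[OF _ assms(3)] smooth_on_partial assms(2))
  obtain d1 where d1: "d1 > 0" "\<And>y. dist y x < d1 \<Longrightarrow> dist (?F y) (?F x) < \<epsilon>"
    using cont(1) \<open>\<epsilon> > 0\<close> unfolding continuous_at_eps_delta by blast
  obtain d2 where d2: "d2 > 0" "\<And>y. dist y x < d2 \<Longrightarrow> dist (?G y) (?G x) < \<epsilon>"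
    using cont(2) \<open>\<epsilon> > 0\<close> unfolding continuous_at_eps_delta by blast
  obtain d3 where d3: "d3 > 0" "ball x d3 \<subseteq> \<Omega>"
    using assms(1,3) openE by blast
  \<comment> \<open>Points reached by two steps of length at most \<open>h\<close> are within
    \<open>2 * h\<close> of \<open>x\<close>; the divisor 3 keeps this below all three
    radii.\<close>
  define h where "h = min d1 (min d2 d3) / 3"
  have h: "h > 0" "2 * h < d1" "2 * h < d2" "2 * h < d3"
    using d1 d2 d3 by (auto simp: h_def)
  have near: "dist (x + s *\<^sub>R ?e k + t *\<^sub>R ?e l) x \<le> 2 * h"
    if "0 \<le> s" "s \<le> h" "0 \<le> t" "t \<le> h" for s t k l
  proof -
    have "norm (s *\<^sub>R ?e k + t *\<^sub>R ?e l) \<le> norm (s *\<^sub>R ?e k) + norm (t *\<^sub>R ?e l)"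
      by (rule norm_triangle_ineq)
    also have "\<dots> \<le> 2 * h" using that by (simp add: norm_axis_1)
    finally show ?thesis by (simp add: dist_norm add.assoc)
  qed
  have mem: "x + s *\<^sub>R ?e k + t *\<^sub>R ?e l \<in> \<Omega>"
    if "0 \<le> s" "s \<le> h" "0 \<le> t" "t \<le> h" for s t k l
    using near[OF that, of k l] h d3 by (auto simp: dist_commute)
  obtain s t where st: "0 < s" "s < h" "0 < t" "t < h"
    "f (x + h *\<^sub>R ?e i + h *\<^sub>R ?e j) - f (x + h *\<^sub>R ?e i) - f (x + h *\<^sub>R ?e j) + f x
      = h * h * ?G (x + s *\<^sub>R ?e i + t *\<^sub>R ?e j)"
    using second_difference[OF h(1) assms(2) mem, of i j] by blast
  obtain s' t' where st': "0 < s'" "s' < h" "0 < t'" "t' < h"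
    "f (x + h *\<^sub>R ?e j + h *\<^sub>R ?e i) - f (x + h *\<^sub>R ?e j) - f (x + h *\<^sub>R ?e i) + f x
      = h * h * ?F (x + s' *\<^sub>R ?e j + t' *\<^sub>R ?e i)"
    using second_difference[OF h(1) assms(2) mem, of j i] by blast
  have "f (x + h *\<^sub>R ?e j + h *\<^sub>R ?e i) = f (x + h *\<^sub>R ?e i + h *\<^sub>R ?e j)"
    by (simp add: add.commute add.left_commute)
  then have "h * h * ?G (x + s *\<^sub>R ?e i + t *\<^sub>R ?e j) = h * h * ?F (x + s' *\<^sub>R ?e j + t' *\<^sub>R ?e i)"
    using st(5) st'(5) by linarith
  then have eq: "?G (x + s *\<^sub>R ?e i + t *\<^sub>R ?e j) = ?F (x + s' *\<^sub>R ?e j + t' *\<^sub>R ?e i)"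
    using h(1) by simp
  have "dist (?G (x + s *\<^sub>R ?e i + t *\<^sub>R ?e j)) (?G x) < \<epsilon>"
    using near[of s t i j] st h by (intro d2) auto
  moreover have "dist (?F (x + s' *\<^sub>R ?e j + t' *\<^sub>R ?e i)) (?F x) < \<epsilon>"
    using near[of s' t' j i] st' h by (intro d1) auto
  ultimately have "\<bar>?F x - ?G x\<bar> < 2 * \<epsilon>"
    unfolding eq dist_real_def by linarith
  then show False by (simp add: \<epsilon>_def)
qed

section \<open>Constant and quadratic functions\<close>

lemma constant_if_partials_zero:
  assumes "convex \<Omega>" "\<And>x. x \<in> \<Omega> \<Longrightarrow> f differentiable (at x)"
    and "\<And>i x. x \<in> \<Omega> \<Longrightarrow> partial i f x = 0"
  shows "\<exists>c. \<forall>x\<in>\<Omega>. f x = c"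
proof (rule has_derivative_zero_constant[OF assms(1)])
  fix x assume "x \<in> \<Omega>"
  then show "(f has_derivative (\<lambda>h. 0)) (at x within \<Omega>)"
    using has_derivative_via_partial[OF assms(2)] assms(3)
    by (auto intro: has_derivative_at_withinI)
qed

lemma has_derivative_quadratic:
  fixes h x :: "real^3"
  assumes "\<And>k l. q k l = q l k"
  shows "((\<lambda>y. b + h \<bullet> y + (\<Sum>k\<in>UNIV. \<Sum>l\<in>UNIV. q k l * y$k * y$l) / 2) has_derivative
    (\<lambda>v. \<Sum>k\<in>UNIV. (h$k + (\<Sum>l\<in>UNIV. q k l * x$l)) * v$k)) (at x)"
proof -
  \<comment> \<open>The product rule gives two sums that coincide by the symmetry of
    \<open>q\<close>, which absorbs the factor 1/2.\<close>
  have "h \<bullet> v + (\<Sum>k\<in>UNIV. \<Sum>l\<in>UNIV. q k l * v$k * x$l + q k l * x$k * v$l) / 2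
      = (\<Sum>k\<in>UNIV. (h$k + (\<Sum>l\<in>UNIV. q k l * x$l)) * v$k)" for v
    unfolding sum_3 inner_vec_def inner_real_def
    by (simp only: assms[of 2 1] assms[of 3 1] assms[of 3 2]) algebra
  moreover have "((\<lambda>y. b + h \<bullet> y + (\<Sum>k\<in>UNIV. \<Sum>l\<in>UNIV. q k l * y$k * y$l) / 2) has_derivative
    (\<lambda>v. h \<bullet> v + (\<Sum>k\<in>UNIV. \<Sum>l\<in>UNIV. q k l * v$k * x$l + q k l * x$k * v$l) / 2)) (at x)"
    by (auto intro!: derivative_eq_intros bounded_linear_imp_has_derivative[OF bounded_linear_vec_nth] sum.cong simp: algebra_simps)
  ultimately show ?thesis by simp
qed

lemma partial_quadratic:
  fixes h x :: "real^3"
  assumes "open \<Omega>" "x \<in> \<Omega>" "\<And>k l. q k l = q l k"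
    and "\<And>y. y \<in> \<Omega> \<Longrightarrow> f y = b + h \<bullet> y + (\<Sum>k\<in>UNIV. \<Sum>l\<in>UNIV. q k l * y$k * y$l) / 2"
  shows "partial i f x = h$i + (\<Sum>l\<in>UNIV. q i l * x$l)"
  using partial_cong[OF assms(1,2,4), where i=i]
    has_derivative_partial[OF has_derivative_quadratic[OF assms(3)], where i=i and x=x]
  by (simp add: axis_def if_distrib cong: if_cong)

lemma partial_partial_quadratic:
  fixes h x :: "real^3"
  assumes "open \<Omega>" "x \<in> \<Omega>" "\<And>k l. q k l = q l k"
    and "\<And>y. y \<in> \<Omega> \<Longrightarrow> f y = b + h \<bullet> y + (\<Sum>k\<in>UNIV. \<Sum>l\<in>UNIV. q k l * y$k * y$l) / 2"
  shows "partial j (partial i f) x = q i j"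
proof -
  have "((\<lambda>y. h$i + (\<Sum>l\<in>UNIV. q i l * y$l)) has_derivative (\<lambda>v. \<Sum>l\<in>UNIV. q i l * v$l)) (at x)"
    by (auto intro!: derivative_eq_intros bounded_linear_imp_has_derivative[OF bounded_linear_vec_nth])
  from has_derivative_partial[OF this, of j] show ?thesis
    using partial_cong[OF assms(1,2) partial_quadratic[OF assms(1) _ assms(3,4)]]
    by (simp add: axis_def if_distrib cong: if_cong)
qed

text \<open>Integration in three stages: the second partials are constants \<open>q\<close>, the
  gradient minus its linear part is a constant \<open>h\<close>, and \<open>f\<close> minus the
  resulting quadratic is a constant \<open>b\<close>. Convexity makes functions with zero derivative
  constant at each stage.\<close>

lemma quadratic_if_third_partials_zero:
  assumes "open \<Omega>" "convex \<Omega>" "\<Omega> \<noteq> {}" "smooth_on \<Omega> f"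
    and "\<And>i j k x. x \<in> \<Omega> \<Longrightarrow> partial i (partial j (partial k f)) x = 0"
  shows "\<exists>b (h :: real^3) q. (\<forall>k l. q k l = q l k) \<and>
    (\<forall>x\<in>\<Omega>. \<forall>k l. partial k (partial l f) x = q k l) \<and>
    (\<forall>y\<in>\<Omega>. f y = b + h \<bullet> y + (\<Sum>k\<in>UNIV. \<Sum>l\<in>UNIV. q k l * y$k * y$l) / 2)"
proof -
  note smooth = assms(4) smooth_on_partial[OF assms(4)] smooth_on_partial[OF smooth_on_partial[OF assms(4)]]
  note diff = smooth[THEN smooth_on_differentiable]
  have "\<exists>c. \<forall>x\<in>\<Omega>. partial k (partial l f) x = c" for k l
    by (rule constant_if_partials_zero[OF assms(2)]) (auto simp: assms(5) diff)
  then obtain q where q: "\<And>k l x. x \<in> \<Omega> \<Longrightarrow> partial k (partial l f) x = q k l"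
    by metis
  \<comment> \<open>The constants inherit their symmetry from the derivatives at some point, so
    \<open>\<Omega>\<close> must be nonempty.\<close>
  have sym: "q k l = q l k" for k l
    using assms(3) partial_commute[OF assms(1,4)] q by (metis ex_in_conv)
  have "\<exists>c. \<forall>x\<in>\<Omega>. partial i f x - (\<Sum>l\<in>UNIV. q i l * x$l) = c" for i
  proof (rule has_derivative_zero_constant[OF assms(2)])
    fix x assume x: "x \<in> \<Omega>"
    have "((\<lambda>x. partial i f x - (\<Sum>l\<in>UNIV. q i l * x$l)) has_derivative
      (\<lambda>v. (\<Sum>k\<in>UNIV. partial k (partial i f) x * v$k) - (\<Sum>l\<in>UNIV. q i l * v$l))) (at x)"
      by (intro has_derivative_diff has_derivative_via_partial diff(2) x) (auto intro!: derivative_eq_intros bounded_linear_imp_has_derivative[OF bounded_linear_vec_nth])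
    then show "((\<lambda>x. partial i f x - (\<Sum>l\<in>UNIV. q i l * x$l)) has_derivative (\<lambda>v. 0)) (at x within \<Omega>)"
      using x by (auto simp: q sym[of _ i] intro: has_derivative_at_withinI)
  qed
  then obtain h' where h': "\<And>i x. x \<in> \<Omega> \<Longrightarrow> partial i f x - (\<Sum>l\<in>UNIV. q i l * x$l) = h' i"
    by metis
  define h :: "real^3" where "h = (\<chi> i. h' i)"
  \<comment> \<open>The leading 0 stands for the constant term in
    \<open>has_derivative_quadratic\<close>.\<close>
  have "\<exists>c. \<forall>x\<in>\<Omega>. f x - (0 + h \<bullet> x + (\<Sum>k\<in>UNIV. \<Sum>l\<in>UNIV. q k l * x$k * x$l) / 2) = c"
  proof (rule has_derivative_zero_constant[OF assms(2)])
    fix x assume x: "x \<in> \<Omega>"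
    have *: "partial i f x = h $ i + (\<Sum>l\<in>UNIV. q i l * x$l)" for i
      using h'[OF x, of i] by (simp add: h_def)
    have "((\<lambda>x. f x - (0 + h \<bullet> x + (\<Sum>k\<in>UNIV. \<Sum>l\<in>UNIV. q k l * x$k * x$l) / 2)) has_derivative (\<lambda>v. (\<Sum>i\<in>UNIV. partial i f x * v$i)
        - (\<Sum>i\<in>UNIV. (h$i + (\<Sum>l\<in>UNIV. q i l * x$l)) * v$i))) (at x)"
      by (intro has_derivative_diff has_derivative_via_partial diff(1) x has_derivative_quadratic sym)
    then have "((\<lambda>x. f x - (0 + h \<bullet> x + (\<Sum>k\<in>UNIV. \<Sum>l\<in>UNIV. q k l * x$k * x$l) / 2)) has_derivative (\<lambda>v. 0)) (at x)"
      by (simp only: * diff_self)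
    then show "((\<lambda>x. f x - (0 + h \<bullet> x + (\<Sum>k\<in>UNIV. \<Sum>l\<in>UNIV. q k l * x$k * x$l) / 2)) has_derivative (\<lambda>v. 0)) (at x within \<Omega>)"
      by (rule has_derivative_at_withinI)
  qed
  then obtain b where b: "\<forall>x\<in>\<Omega>. f x - (0 + h \<bullet> x + (\<Sum>k\<in>UNIV. \<Sum>l\<in>UNIV. q k l * x$k * x$l) / 2) = b"
    by blast
  have "f x = b + h \<bullet> x + (\<Sum>k\<in>UNIV. \<Sum>l\<in>UNIV. q k l * x$k * x$l) / 2" if "x \<in> \<Omega>" for x
    using bspec[OF b that] by linarith
  with sym q show ?thesis by blast
qed

section \<open>Equilibrium in terms of the derivatives of the strain\<close>

lemma smooth_on_strain:
  assumes "open \<Omega>" "displacement_field \<Omega> u"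
  shows "smooth_on \<Omega> (strain u l m)"
proof -
  have "strain u l m = (\<lambda>x. (1/2) * (partial m (\<lambda>y. u y $ l) x + partial l (\<lambda>y. u y $ m) x))"
    by (simp add: strain_def fun_eq_iff)
  moreover have "smooth_on \<Omega> (\<lambda>y. u y $ k)" for k
    using assms(2) by (simp add: displacement_field_def)
  ultimately show ?thesis
    by (simp only: smooth_on_cmult smooth_on_add smooth_on_partial assms(1))
qed

lemma partial_strain:
  assumes "displacement_field \<Omega> u" "x \<in> \<Omega>"
  shows "partial j (strain u l m) x
    = (partial j (partial m (\<lambda>y. u y $ l)) x + partial j (partial l (\<lambda>y. u y $ m)) x) / 2"
proof -
  have eq: "strain u l m = (\<lambda>x. (1/2) * (partial m (\<lambda>y. u y $ l) x + partial l (\<lambda>y. u y $ m) x))"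
    by (simp add: strain_def fun_eq_iff)
  have D: "partial k (\<lambda>y. u y $ i) differentiable (at x)" for k i
    using assms smooth_on_partial smooth_on_differentiable
    by (metis displacement_field_def)
  show ?thesis
    unfolding eq by (simp only: partial_cmult[OF differentiable_add[OF D D]] partial_add[OF D D])
qed

lemma partial_partial_strain:
  assumes "open \<Omega>" "displacement_field \<Omega> u" "x \<in> \<Omega>"
  shows "partial i (partial j (strain u l m)) x
    = (partial i (partial j (partial m (\<lambda>y. u y $ l))) x + partial i (partial j (partial l (\<lambda>y. u y $ m))) x) / 2"
proof -
  have D: "partial j (partial k (\<lambda>y. u y $ i)) differentiable (at x)" for j k i
    using assms(2,3) smooth_on_partial smooth_on_differentiable
    by (metis displacement_field_def)
  have "partial i (partial j (strain u l m)) x = partial i (\<lambda>x. (1/2) *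
      (partial j (partial m (\<lambda>y. u y $ l)) x + partial j (partial l (\<lambda>y. u y $ m)) x)) x"
    by (rule partial_cong[OF assms(1,3)]) (simp add: partial_strain[OF assms(2)])
  then show ?thesis
    by (simp only: partial_cmult[OF differentiable_add[OF D D]] partial_add[OF D D])
qed

text \<open>The tensors are constant, so differentiation passes through all the sums and the
  equations become pointwise linear relations between derivatives of the strain.\<close>

lemma equilibrium_iff:
  assumes "open \<Omega>" "displacement_field \<Omega> u"
  shows "equilibrium \<Omega> (C, M, A) u \<longleftrightarrow> (\<forall>x\<in>\<Omega>. \<forall>i.
    (\<Sum>j\<in>UNIV. (\<Sum>l\<in>UNIV. \<Sum>m\<in>UNIV. C i j l m * partial j (strain u l m) x) +
      (\<Sum>l\<in>UNIV. \<Sum>m\<in>UNIV. \<Sum>n\<in>UNIV. M i j l m n * partial j (partial n (strain u l m)) x)) -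
    (\<Sum>j\<in>UNIV. \<Sum>k\<in>UNIV.
      (\<Sum>l\<in>UNIV. \<Sum>m\<in>UNIV. M l m i j k * partial k (partial j (strain u l m)) x) +
      (\<Sum>l\<in>UNIV. \<Sum>m\<in>UNIV. \<Sum>n\<in>UNIV.
        A i j k l m n * partial k (partial j (partial n (strain u l m))) x)) = 0)"
proof -
  note smooth = smooth_on_strain[OF assms] smooth_on_partial smooth_on_sum[OF assms(1)]
    smooth_on_cmult[OF assms(1)] smooth_on_add[OF assms(1)]
  note diff = smooth_on_differentiable[of \<Omega>]
  have stress: "partial k (stress (C, M, A) u i j) x =
      (\<Sum>l\<in>UNIV. \<Sum>m\<in>UNIV. C i j l m * partial k (strain u l m) x) +
      (\<Sum>l\<in>UNIV. \<Sum>m\<in>UNIV. \<Sum>n\<in>UNIV. M i j l m n * partial k (partial n (strain u l m)) x)"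
    if "x \<in> \<Omega>" for i j k x
  proof -
    have "stress (C, M, A) u i j = (\<lambda>x.
       (\<Sum>l\<in>UNIV. \<Sum>m\<in>UNIV. C i j l m * strain u l m x) +
       (\<Sum>l\<in>UNIV. \<Sum>m\<in>UNIV. \<Sum>n\<in>UNIV. M i j l m n * partial n (strain u l m) x))"
      by (simp add: fun_eq_iff)
    then show ?thesis
      by (simp add: partial_add partial_sum[OF assms(1)] partial_cmult diff smooth that)
  qed
  have hyper_stress: "partial h (hyper_stress (C, M, A) u i j k) x =
      (\<Sum>l\<in>UNIV. \<Sum>m\<in>UNIV. M l m i j k * partial h (strain u l m) x) +
      (\<Sum>l\<in>UNIV. \<Sum>m\<in>UNIV. \<Sum>n\<in>UNIV. A i j k l m n * partial h (partial n (strain u l m)) x)"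
    if "x \<in> \<Omega>" for h i j k x
  proof -
    have "hyper_stress (C, M, A) u i j k = (\<lambda>x.
       (\<Sum>l\<in>UNIV. \<Sum>m\<in>UNIV. M l m i j k * strain u l m x) +
       (\<Sum>l\<in>UNIV. \<Sum>m\<in>UNIV. \<Sum>n\<in>UNIV. A i j k l m n * partial n (strain u l m) x))"
      by (simp add: fun_eq_iff)
    then show ?thesis
      by (simp add: partial_add partial_sum[OF assms(1)] partial_cmult diff smooth that)
  qed
  have "partial g (partial h (hyper_stress (C, M, A) u i j k)) x =
      (\<Sum>l\<in>UNIV. \<Sum>m\<in>UNIV. M l m i j k * partial g (partial h (strain u l m)) x) +
      (\<Sum>l\<in>UNIV. \<Sum>m\<in>UNIV. \<Sum>n\<in>UNIV. A i j k l m n * partial g (partial h (partial n (strain u l m))) x)"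
    if "x \<in> \<Omega>" for g h i j k x
    by (subst partial_cong[OF assms(1) that hyper_stress], assumption)
      (simp add: partial_add partial_sum[OF assms(1)] partial_cmult diff smooth that)
  then show ?thesis
    unfolding equilibrium_def by (simp add: stress)
qed

section \<open>The tetragonal symmetry groups\<close>

text \<open>Signed permutation matrices that preserve the third axis, that is, the symmetries of a
  square prism. Carrying \<open>p\<close> and \<open>s\<close> explicitly reduces tensor invariance
  to an identity between two components.\<close>

definition tetragonal_matrix :: "(3 \<Rightarrow> 3) \<Rightarrow> (3 \<Rightarrow> real) \<Rightarrow> real^3^3 \<Rightarrow> bool" where
  "tetragonal_matrix p s Q \<longleftrightarrow> (p = id \<or> p = Transposition.transpose 1 2) \<and> (\<forall>i. s i = 1 \<or> s i = - 1) \<and>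
     (\<forall>i a. Q $ i $ a = (if a = p i then s i else 0))"

lemma tetragonal_matrix_sum:
  assumes "tetragonal_matrix p s Q"
  shows "(\<Sum>a\<in>UNIV. Q $ i $ a * f a) = s i * f (p i)"
proof -
  have "Q $ i $ a * f a = (if a = p i then s i * f (p i) else 0)" for a
    using assms by (auto simp: tetragonal_matrix_def)
  then show ?thesis by simp
qed

lemma tetragonal_matrix_transpose:
  assumes "tetragonal_matrix p s Q"
  shows "tetragonal_matrix p (s \<circ> p) (Finite_Cartesian_Product.transpose Q)" "orthogonal_matrix Q"
proof -
  \<comment> \<open>Both admissible permutations are involutions, so the transpose has the same
    \<open>p\<close> with relabelled signs.\<close>
  have pp: "p (p i) = i" for i
    using assms by (auto simp: tetragonal_matrix_def)
  show "tetragonal_matrix p (s \<circ> p) (Finite_Cartesian_Product.transpose Q)"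
    using assms pp by (auto simp: tetragonal_matrix_def transpose_def)
  have "(Q ** Finite_Cartesian_Product.transpose Q) $ i $ j = mat 1 $ i $ j" for i j
  proof -
    have "(Q ** Finite_Cartesian_Product.transpose Q) $ i $ j = s i * Q $ j $ p i"
      by (simp add: matrix_matrix_mult_def tetragonal_matrix_sum[OF assms] transpose_def)
    also have "Q $ j $ p i = (if i = j then s j else 0)"
      using assms pp[of i] pp[of j] by (auto simp: tetragonal_matrix_def)
    also have "s i * \<dots> = mat 1 $ i $ j"
      using assms by (auto simp: tetragonal_matrix_def mat_def dest: spec[of _ i])
    finally show ?thesis .
  qed
  then have "Q ** Finite_Cartesian_Product.transpose Q = mat 1"
    by (simp add: vec_eq_iff)
  then show "orthogonal_matrix Q"
    using matrix_left_right_inverse unfolding orthogonal_matrix_def by blast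
qed

lemma tetragonal_matrix_mult:
  assumes "tetragonal_matrix p s Q" "tetragonal_matrix p' s' Q'"
  shows "tetragonal_matrix (p' \<circ> p) (\<lambda>i. s i * s' (p i)) (Q ** Q')"
  unfolding tetragonal_matrix_def
proof (intro conjI)
  show "p' \<circ> p = id \<or> p' \<circ> p = Transposition.transpose 1 2"
    using assms by (auto simp: tetragonal_matrix_def)
  have "s i = 1 \<or> s i = - 1" "s' (p i) = 1 \<or> s' (p i) = - 1" for i
    using assms by (simp_all add: tetragonal_matrix_def)
  then show "\<forall>i. s i * s' (p i) = 1 \<or> s i * s' (p i) = - 1"
    by (metis mult_1 mult_minus1 minus_minus)
  show "\<forall>i a. (Q ** Q') $ i $ a = (if a = (p' \<circ> p) i then s i * s' (p i) else 0)"
    using assms(2)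
    by (auto simp: matrix_matrix_mult_def tetragonal_matrix_sum[OF assms(1)] tetragonal_matrix_def)
qed

lemma inv_O3: "orthogonal_matrix Q \<Longrightarrow> inv\<^bsub>O3\<^esub> Q = Finite_Cartesian_Product.transpose Q"
  unfolding m_inv_def O3_def
  by (rule the_equality)
    (auto simp: orthogonal_matrix_def orthogonal_matrix_transpose,
      metis matrix_mul_assoc matrix_mul_lid matrix_mul_rid)

lemma generate_O3_tetragonal:
  assumes "Q \<in> generate O3 S" "\<And>R. R \<in> S \<Longrightarrow> \<exists>p s. tetragonal_matrix p s R"
  shows "\<exists>p s. tetragonal_matrix p s Q"
  using assms
proof (induction rule: generate.induct)
  case one
  have "tetragonal_matrix id (\<lambda>i. 1) (mat 1)"
    by (auto simp: tetragonal_matrix_def mat_def)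
  then show ?case by (auto simp: O3_def)
next
  case (inv h)
  then show ?case
    by (metis inv_O3 tetragonal_matrix_transpose)
next
  case (eng h1 h2)
  then show ?case
    using tetragonal_matrix_mult by (simp add: O3_def) metis
qed auto

text \<open>The determinant separates \<open>D4\<close> from \<open>D4_Z2c\<close>, where
  \<open>- mat 1\<close> has determinant -1. The invariance of the test tensor
  \<open>tetragonal_M\<close> depends on it.\<close>

lemma generate_O3_det:
  assumes "Q \<in> generate O3 S" "\<And>R. R \<in> S \<Longrightarrow> orthogonal_matrix R \<and> det R = 1"
  shows "det Q = 1"
  using assms
proof (induction rule: generate.induct)
  case (inv h)
  then show ?case by (simp add: inv_O3)
qed (auto simp: O3_def det_mul)

lemma tetragonal_rotations:
  "tetragonal_matrix (Transposition.transpose 1 2) (\<lambda>i. if i = 1 then - 1 else 1) (rotation_e3 (pi / 2))"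
  "tetragonal_matrix id (\<lambda>i. if i = 1 then 1 else - 1) (rotation_e1 pi)"
  by (auto simp: tetragonal_matrix_def rotation_e3_def rotation_e1_def forall_3)

lemma D4_tetragonal:
  assumes "Q \<in> D4"
  shows "\<exists>p s. tetragonal_matrix p s Q" "det Q = 1"
proof -
  show "\<exists>p s. tetragonal_matrix p s Q"
    using assms tetragonal_rotations unfolding D4_def
    by (elim generate_O3_tetragonal) auto
  show "det Q = 1"
    using assms tetragonal_matrix_transpose(2)[OF tetragonal_rotations(1)]
      tetragonal_matrix_transpose(2)[OF tetragonal_rotations(2)]
    unfolding D4_def
    by (elim generate_O3_det) (auto simp: det_3 rotation_e1_def rotation_e3_def)
qed

lemma D4_Z2c_tetragonal:
  assumes "Q \<in> D4_Z2c"
  shows "\<exists>p s. tetragonal_matrix p s Q"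
proof -
  have "tetragonal_matrix id (\<lambda>i. - 1) (- mat 1)"
    by (auto simp: tetragonal_matrix_def mat_def)
  then show ?thesis
    using assms D4_tetragonal(1) unfolding D4_Z2c_def
    by (elim generate_O3_tetragonal) auto
qed

lemma tetragonal_matrix_det:
  assumes "tetragonal_matrix p s Q"
  shows "det Q = s 1 * s 2 * s 3 * (if p = id then 1 else - 1)"
proof -
  \<comment> \<open>The test \<open>p = id\<close> can stand for the sign of the permutation only if
    the two cases are distinct.\<close>
  have "Transposition.transpose 1 (2::3) \<noteq> id"
  proof
    assume "Transposition.transpose 1 (2::3) = id"
    from fun_cong[OF this, of 1] show False by simp
  qed
  then show ?thesis
    using assms by (auto simp: tetragonal_matrix_def det_3)
qed

section \<open>Action of the groups on tensors\<close>

lemma invariant4_tetragonal: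
  assumes "tetragonal_matrix p s Q"
  shows "(\<Sum>a\<in>UNIV. \<Sum>b\<in>UNIV. \<Sum>c\<in>UNIV. \<Sum>d\<in>UNIV.
        Q $ i $ a * Q $ j $ b * Q $ k $ c * Q $ l $ d * T a b c d)
     = s i * s j * s k * s l * T (p i) (p j) (p k) (p l)"
proof -
  \<comment> \<open>Once the sums are nested, each collapses to the only nonzero entry in its row of
    \<open>Q\<close>.\<close>
  have "(\<Sum>a\<in>UNIV. \<Sum>b\<in>UNIV. \<Sum>c\<in>UNIV. \<Sum>d\<in>UNIV.
        Q $ i $ a * Q $ j $ b * Q $ k $ c * Q $ l $ d * T a b c d)
      = (\<Sum>a\<in>UNIV. Q $ i $ a * (\<Sum>b\<in>UNIV. Q $ j $ b * (\<Sum>c\<in>UNIV. Q $ k $ c *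
          (\<Sum>d\<in>UNIV. Q $ l $ d * T a b c d))))"
    by (simp only: sum_distrib_left mult.assoc)
  then show ?thesis
    by (simp only: tetragonal_matrix_sum[OF assms] mult.assoc)
qed

lemma invariant5_tetragonal:
  assumes "tetragonal_matrix p s Q"
  shows "(\<Sum>a\<in>UNIV. \<Sum>b\<in>UNIV. \<Sum>c\<in>UNIV. \<Sum>d\<in>UNIV. \<Sum>e\<in>UNIV.
        Q $ i $ a * Q $ j $ b * Q $ k $ c * Q $ l $ d * Q $ m $ e * T a b c d e)
     = s i * s j * s k * s l * s m * T (p i) (p j) (p k) (p l) (p m)"
proof -
  have "(\<Sum>a\<in>UNIV. \<Sum>b\<in>UNIV. \<Sum>c\<in>UNIV. \<Sum>d\<in>UNIV. \<Sum>e\<in>UNIV.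
        Q $ i $ a * Q $ j $ b * Q $ k $ c * Q $ l $ d * Q $ m $ e * T a b c d e)
      = (\<Sum>a\<in>UNIV. Q $ i $ a * (\<Sum>b\<in>UNIV. Q $ j $ b * (\<Sum>c\<in>UNIV. Q $ k $ c *
          (\<Sum>d\<in>UNIV. Q $ l $ d * (\<Sum>e\<in>UNIV. Q $ m $ e * T a b c d e)))))"
    by (simp only: sum_distrib_left mult.assoc)
  then show ?thesis
    by (simp only: tetragonal_matrix_sum[OF assms] mult.assoc)
qed

text \<open>A quarter turn about the third axis and half turns about the first and third. The half
  turns annihilate components by parity of indices; the quarter turn identifies components that
  differ by exchanging 1 and 2, up to sign.\<close>

lemma D4_Z2c_members:
  "\<exists>Q\<in>D4_Z2c. tetragonal_matrix (Transposition.transpose 1 2) (\<lambda>i. if i = 1 then - 1 else 1) Q"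
  "\<exists>Q\<in>D4_Z2c. tetragonal_matrix id (\<lambda>i. if i = 1 then 1 else - 1) Q"
  "\<exists>Q\<in>D4_Z2c. tetragonal_matrix id (\<lambda>i. if i = 3 then 1 else - 1) Q"
proof -
  have mem: "rotation_e3 (pi / 2) \<in> D4_Z2c" "rotation_e1 pi \<in> D4_Z2c"
    unfolding D4_Z2c_def D4_def by (auto intro!: generate.incl)
  then have "rotation_e3 (pi / 2) ** rotation_e3 (pi / 2) \<in> D4_Z2c"
    using generate.eng[OF mem(1,1)[unfolded D4_Z2c_def]] by (simp add: D4_Z2c_def O3_def)
  \<comment> \<open>The half turn about the third axis is the square of the quarter turn; these are
    its signs.\<close>
  moreover have "(\<lambda>i. (if i = 1 then - 1 else 1) * (if Transposition.transpose 1 2 i = 1 then - 1 else 1))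
      = (\<lambda>i::3. if i = 3 then 1 else - 1 :: real)"
    by (simp add: fun_eq_iff forall_3)
  then have "tetragonal_matrix id (\<lambda>i. if i = 3 then 1 else - 1) (rotation_e3 (pi / 2) ** rotation_e3 (pi / 2))"
    using tetragonal_matrix_mult[OF tetragonal_rotations(1,1)] by simp
  ultimately show
    "\<exists>Q\<in>D4_Z2c. tetragonal_matrix (Transposition.transpose 1 2) (\<lambda>i. if i = 1 then - 1 else 1) Q"
    "\<exists>Q\<in>D4_Z2c. tetragonal_matrix id (\<lambda>i. if i = 1 then 1 else - 1) Q"
    "\<exists>Q\<in>D4_Z2c. tetragonal_matrix id (\<lambda>i. if i = 3 then 1 else - 1) Q"
    using mem tetragonal_rotations by blast+
qed

section \<open>Test materials\<close>

text \<open>The arguments are the components of the tensor in Voigt notation.\<close>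
definition tetragonal_C :: "real \<Rightarrow> real \<Rightarrow> real \<Rightarrow> real \<Rightarrow> real \<Rightarrow> real \<Rightarrow> tensor4" where
  "tetragonal_C c11 c12 c13 c33 c44 c66 i j l m =
    (if i = j \<and> l = m then
       (if i = l then (if i = 3 then c33 else c11) else if i = 3 \<or> l = 3 then c13 else c12)
     else if i = l \<and> j = m \<or> i = m \<and> j = l then (if i = 3 \<or> j = 3 then c44 else c66)
     else 0)"

text \<open>
  The orbit of the component \<open>M\<^sub>1\<^sub>2\<^sub>1\<^sub>3\<^sub>1\<close>. Invariance under \<^const>\<open>D4\<close> forces
  \<open>M\<^sub>2\<^sub>1\<^sub>2\<^sub>3\<^sub>2 = - M\<^sub>1\<^sub>2\<^sub>1\<^sub>3\<^sub>1\<close>; it is this sign that keeps the harmonicity of \<open>g\<close> from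
  cancelling the two contributions.
\<close>
definition tetragonal_M :: tensor5 where
  "tetragonal_M i j l m n =
    (if i = 1 \<and> j = 2 \<or> i = 2 \<and> j = 1 then 1 else 0) *
    (if l = 3 \<and> m = n \<or> l = n \<and> m = 3 then (if n = 1 then 1 else if n = 2 then - 1 else 0) else 0)"

text \<open>The tensor depends only on which indices agree and which equal 3, and \<open>p\<close>
  preserves both. It is nonzero only where the indices pair up, and there the signs cancel.\<close>

lemma tetragonal_C_in_class:
  "(tetragonal_C c11 c12 c13 c33 c44 c66, \<lambda>_ _ _ _ _. 0, \<lambda>_ _ _ _ _ _. 0) \<in> tetragonal_D4_class"
proof -
  let ?C = "tetragonal_C c11 c12 c13 c33 c44 c66"
  have "invariant4 D4_Z2c ?C"
    unfolding invariant4_def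
  proof (intro ballI allI)
    fix Q i j k l assume "Q \<in> D4_Z2c"
    then obtain p s where ps: "tetragonal_matrix p s Q"
      using D4_Z2c_tetragonal by blast
    have sq: "s i * s i = 1" for i
      using ps unfolding tetragonal_matrix_def by (metis mult_1 minus_mult_minus)
    then have sq': "s i * (s i * y) = y" for i y
      by (simp flip: mult.assoc)
    have p: "p a = p b \<longleftrightarrow> a = b" "p a = 3 \<longleftrightarrow> a = 3" for a b
      using ps unfolding tetragonal_matrix_def
      by (auto simp: Transposition.transpose_def split: if_splits)
    have "?C (p i) (p j) (p k) (p l) = ?C i j k l"
      unfolding tetragonal_C_def p by (rule refl)
    moreover have "s i * s j * s k * s l * ?C i j k l = ?C i j k l"
      by (auto simp: tetragonal_C_def ac_simps sq sq')
    ultimately show "(\<Sum>a\<in>UNIV. \<Sum>b\<in>UNIV. \<Sum>c\<in>UNIV. \<Sum>d\<in>UNIV.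
        Q $ i $ a * Q $ j $ b * Q $ k $ c * Q $ l $ d * ?C a b c d) = ?C i j k l"
      by (simp add: invariant4_tetragonal[OF ps])
  qed
  then show ?thesis
    by (auto simp: tetragonal_D4_class_def strain_gradient_materials_def invariant5_def
        invariant6_def tetragonal_C_def)
qed

text \<open>Where the tensor is nonzero the signs multiply to \<open>s 1 * s 2 * s 3\<close>, and
  exchanging 1 and 2 reverses its sign. The two effects combine to the factor \<open>det Q\<close>,
  which is 1 on \<open>D4\<close>.\<close>

lemma tetragonal_M_in_class:
  "(\<lambda>_ _ _ _. 0, tetragonal_M, \<lambda>_ _ _ _ _ _. 0) \<in> tetragonal_D4_class"
proof -
  have "invariant5 D4 tetragonal_M"
    unfolding invariant5_def
  proof (intro ballI allI)
    fix Q i j k l m assume Q: "Q \<in> D4"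
    then obtain p s where ps: "tetragonal_matrix p s Q"
      using D4_tetragonal by blast
    have sq: "s i * s i = 1" for i
      using ps unfolding tetragonal_matrix_def by (metis mult_1 minus_mult_minus)
    have det: "s 1 * s 2 * s 3 * (if p = id then 1 else - 1) = 1"
      using D4_tetragonal(2)[OF Q] tetragonal_matrix_det[OF ps] by simp
    have p: "p = id \<or> p = Transposition.transpose 1 2"
      using ps by (simp add: tetragonal_matrix_def)
    \<comment> \<open>Factoring the tensor keeps the case analysis small: the exchange of 1 and 2
      fixes \<open>f\<close> and negates \<open>g\<close>.\<close>
    define f :: "3 \<Rightarrow> 3 \<Rightarrow> real" where "f i j = (if i = 1 \<and> j = 2 \<or> i = 2 \<and> j = 1 then 1 else 0)" for i j
    define g :: "3 \<Rightarrow> 3 \<Rightarrow> 3 \<Rightarrow> real" where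
      "g l m n = (if l = 3 \<and> m = n \<or> l = n \<and> m = 3 then (if n = 1 then 1 else if n = 2 then - 1 else 0) else 0)"
      for l m n
    have M: "tetragonal_M i j l m n = f i j * g l m n" for i j l m n
      by (simp add: tetragonal_M_def f_def g_def)
    have swap: "tetragonal_M (p i) (p j) (p k) (p l) (p m)
        = (if p = id then 1 else - 1) * tetragonal_M i j k l m"
    proof (cases "p = id")
      case False
      with p have p': "p = Transposition.transpose 1 2" by blast
      have p123: "p 1 = 2" "p 2 = 1" "p 3 = 3"
        by (simp_all add: p')
      have "\<forall>i j. f (p i) (p j) = f i j" "\<forall>l m n. g (p l) (p m) (p n) = - g l m n"
        unfolding forall_3 p123 by (simp_all add: f_def g_def)
      with False show ?thesis by (simp add: M)
    qed auto
    have signs: "s i * s j * s k * s l * s m * tetragonal_M i j k l m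
        = s 1 * s 2 * s 3 * tetragonal_M i j k l m"
    proof -
      have f: "s i * s j * f i j = s 1 * s 2 * f i j"
        by (simp add: f_def)
      \<comment> \<open>The nonzero entries of \<open>g\<close> have one index 3 and an equal pair,
        whose signs square to 1.\<close>
      have g: "s k * s l * s m * g k l m = s 3 * g k l m"
        using sq by (auto simp: g_def mult.assoc mult.left_commute)
      have "s i * s j * s k * s l * s m * tetragonal_M i j k l m
          = (s i * s j * f i j) * (s k * s l * s m * g k l m)"
        by (simp only: M ac_simps)
      then show ?thesis
        unfolding f g M by (simp only: ac_simps)
    qed
    have "s i * s j * s k * s l * s m * tetragonal_M (p i) (p j) (p k) (p l) (p m)
      = (if p = id then 1 else - 1) * (s i * s j * s k * s l * s m * tetragonal_M i j k l m)"
      unfolding swap by (simp only: mult.left_commute)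
    also have "\<dots> = (s 1 * s 2 * s 3 * (if p = id then 1 else - 1)) * tetragonal_M i j k l m"
      unfolding signs by (simp only: ac_simps)
    finally have "s i * s j * s k * s l * s m * tetragonal_M (p i) (p j) (p k) (p l) (p m)
      = tetragonal_M i j k l m"
      by (simp only: det mult_1)
    then show "(\<Sum>a\<in>UNIV. \<Sum>b\<in>UNIV. \<Sum>c\<in>UNIV. \<Sum>d\<in>UNIV. \<Sum>e\<in>UNIV.
        Q $ i $ a * Q $ j $ b * Q $ k $ c * Q $ l $ d * Q $ m $ e * tetragonal_M a b c d e)
      = tetragonal_M i j k l m"
      by (simp only: invariant5_tetragonal[OF ps])
  qed
  then show ?thesis
    by (auto simp: tetragonal_D4_class_def strain_gradient_materials_def invariant4_def
        invariant6_def tetragonal_M_def insert_commute)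
qed

section \<open>Universal displacements are quadratic\<close>

text \<open>The equilibrium equations are linear in the six moduli, which are arbitrary, so the
  coefficient of each modulus vanishes separately. The excluded index pairs are those with exactly
  one 3.\<close>

lemma universal_second_partials:
  assumes "open \<Omega>" "displacement_field \<Omega> u" "universal_for \<Omega> tetragonal_D4_class u" "x \<in> \<Omega>"
  defines "D \<equiv> \<lambda>i j k. partial j (partial k (\<lambda>y. u y $ i)) x"
  shows "\<forall>j k. (j, k) \<notin> {(2, 3), (1, 3), (3, 2), (3, 1)} \<longrightarrow> D 1 j k = 0"
    "\<forall>j k. (j, k) \<notin> {(2, 3), (1, 3), (3, 2), (3, 1)} \<longrightarrow> D 2 j k = 0"
    "D 2 2 3 = - D 1 1 3" "D 3 1 3 = 0" "D 3 2 3 = 0" "D 3 3 3 = 0" "D 3 1 1 = - D 3 2 2"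
proof -
  have sym: "D i j k = D i k j" for i j k
    using partial_commute[OF assms(1) _ assms(4)] assms(2) by (simp add: D_def displacement_field_def)
  have e: "partial j (strain u l m) x = (D l j m + D m j l) / 2" for j l m
    by (simp add: partial_strain[OF assms(2,4)] D_def)
  have eq: "(\<Sum>j\<in>UNIV. \<Sum>l\<in>UNIV. \<Sum>m\<in>UNIV. tetragonal_C c11 c12 c13 c33 c44 c66 i j l m * ((D l j m + D m j l) / 2)) = 0"
    for c11 c12 c13 c33 c44 c66 i
  proof -
    have "equilibrium \<Omega> (tetragonal_C c11 c12 c13 c33 c44 c66, \<lambda>_ _ _ _ _. 0, \<lambda>_ _ _ _ _ _. 0) u"
      using assms(3) tetragonal_C_in_class unfolding universal_for_def by blast
    from this[unfolded equilibrium_iff[OF assms(1,2)], rule_format, OF assms(4), of i]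
    show ?thesis by (simp add: e)
  qed
  have eq1: "c11 * D 1 1 1 + c12 * D 2 1 2 + c13 * D 3 1 3 + c66 * (D 1 2 2 + D 2 1 2)
      + c44 * (D 1 3 3 + D 3 1 3) = 0"
    and eq2: "c12 * D 1 1 2 + c11 * D 2 2 2 + c13 * D 3 2 3 + c66 * (D 1 1 2 + D 2 1 1)
      + c44 * (D 2 3 3 + D 3 2 3) = 0"
    and eq3: "c13 * (D 1 1 3 + D 2 2 3) + c33 * D 3 3 3
      + c44 * (D 1 1 3 + D 3 1 1 + D 2 2 3 + D 3 2 2) = 0"
    for c11 c12 c13 c33 c44 c66
    using eq[of c11 c12 c13 c33 c44 c66 1] eq[of c11 c12 c13 c33 c44 c66 2] eq[of c11 c12 c13 c33 c44 c66 3]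
    unfolding sum_3 tetragonal_C_def
    by (simp_all add: sym[of _ 2 1] sym[of _ 3 1] sym[of _ 3 2] algebra_simps)
  \<comment> \<open>One modulus at a time is set to 1. The shear moduli give sums such as
    \<open>D 1 2 2 + D 2 1 2\<close>, one summand of which is already zero.\<close>
  have "D 1 1 1 = 0" "D 2 1 2 = 0" "D 3 1 3 = 0" "D 1 2 2 = 0" "D 1 3 3 = 0"
    using eq1[of 1 0 0 0 0] eq1[of 0 1 0 0 0] eq1[of 0 0 1 0 0] eq1[of 0 0 0 1 0] eq1[of 0 0 0 0 1]
    by auto
  moreover have "D 2 2 2 = 0" "D 1 1 2 = 0" "D 3 2 3 = 0" "D 2 1 1 = 0" "D 2 3 3 = 0"
    using eq2[of 1 0 0 0 0] eq2[of 0 1 0 0 0] eq2[of 0 0 1 0 0] eq2[of 0 0 0 1 0] eq2[of 0 0 0 0 1]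
    by auto
  moreover have "D 2 2 3 = - D 1 1 3" "D 3 3 3 = 0" "D 3 1 1 = - D 3 2 2"
    using eq3[of 1 0 0] eq3[of 0 1 0] eq3[of 0 0 1] by auto
  ultimately show "\<forall>j k. (j, k) \<notin> {(2, 3), (1, 3), (3, 2), (3, 1)} \<longrightarrow> D 1 j k = 0"
    "\<forall>j k. (j, k) \<notin> {(2, 3), (1, 3), (3, 2), (3, 1)} \<longrightarrow> D 2 j k = 0"
    "D 2 2 3 = - D 1 1 3" "D 3 1 3 = 0" "D 3 2 3 = 0" "D 3 3 3 = 0" "D 3 1 1 = - D 3 2 2"
    by (simp_all add: forall_3 sym[of _ 2 1])
qed

text \<open>For \<open>u\<^sub>1\<close> and \<open>u\<^sub>2\<close>: of three indices, two are
  both 3 or both different from 3, and reordering brings such a pair into the innermost position,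
  where the second derivative vanishes. For \<open>u\<^sub>3\<close>, \<open>tetragonal_M\<close> is
  needed as well.\<close>

lemma universal_third_partials_zero:
  assumes "open \<Omega>" "displacement_field \<Omega> u" "universal_for \<Omega> tetragonal_D4_class u" "x \<in> \<Omega>"
  shows "partial a (partial b (partial c (\<lambda>y. u y $ i))) x = 0"
proof -
  define T where "T i a b c = partial a (partial b (partial c (\<lambda>y. u y $ i))) x" for i a b c
  have smooth: "smooth_on \<Omega> (\<lambda>y. u y $ i)" for i
    using assms(2) by (simp add: displacement_field_def)
  have swap12: "T i a b c = T i b a c" for i a b c
    unfolding T_def by (rule partial_commute[OF assms(1) smooth_on_partial[OF smooth] assms(4)])
  have swap23: "T i a b c = T i a c b" for i a b c
    unfolding T_def
    by (rule partial_cong[OF assms(1,4)]) (rule partial_commute[OF assms(1) smooth])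
  note C = universal_second_partials[OF assms(1-3)]
  have vanish: "T i a b c = 0" if "\<And>x. x \<in> \<Omega> \<Longrightarrow> partial b (partial c (\<lambda>y. u y $ i)) x = 0" for i a b c
    unfolding T_def using partial_cong[OF assms(1,4) that, where i=a] by simp
  have T12: "T i a b c = 0" if "i = 1 \<or> i = 2" "(b, c) \<notin> {(2, 3), (1, 3), (3, 2), (3, 1)}" for i a b c
    using C(1,2) that by (auto intro!: vanish)
  \<comment> \<open>If \<open>a\<close> is 3, the two 3s are moved inside; otherwise the single 3 is
    moved to the front.\<close>
  have T12_3: "T i a b 3 = 0" if "i = 1 \<or> i = 2" "b \<noteq> 3" for i a b
  proof (cases "a = 3")
    case True
    then show ?thesis
      using swap12[of i 3 b 3] T12[OF that(1), of 3 3 b] by simp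
  next
    case False
    have "T i a b 3 = T i 3 a b"
      using swap23[of i a b 3] swap12[of i a 3 b] by (rule trans)
    with False show ?thesis
      using T12[OF that(1), of a b 3] that(2) by simp
  qed
  have T12_zero: "T 1 a b c = 0" "T 2 a b c = 0" for a b c
  proof -
    have "T i a b c = 0" if i: "i = 1 \<or> i = 2" for i
    proof (cases "b = 3 \<longleftrightarrow> c = 3")
      case True
      then show ?thesis by (intro T12[OF i]) auto
    next
      case False
      then show ?thesis
        using T12_3[OF i, of b a] T12_3[OF i, of c a] swap23[of i a b c] by fastforce
    qed
    then show "T 1 a b c = 0" "T 2 a b c = 0" by simp_all
  qed
  have T3: "T 3 a b 3 = 0" "T 3 a 3 b = 0" "T 3 3 a b = 0" for a b
  proof -
    show "T 3 a b 3 = 0" for a b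
      using C(4-6) exhaust_3[of b] by (auto intro!: vanish)
    then show "T 3 a 3 b = 0" for a b
      by (simp only: swap23[of 3 a 3 b])
    then show "T 3 3 a b = 0"
      by (simp only: swap12[of 3 3 a b])
  qed
  have perm: "T 3 a 2 1 = T 3 a 1 2" "T 3 1 1 2 = T 3 2 1 1" "T 3 2 1 2 = T 3 1 2 2" for a
    using swap23[of 3 a 2 1] swap23[of 3 1 1 2] swap12[of 3 1 2 1] swap12[of 3 2 1 2] by simp_all
  \<comment> \<open>The in-plane harmonicity of \<open>u\<^sub>3\<close>, differentiated once
    more.\<close>
  have T3': "T 3 a 1 1 = - T 3 a 2 2" for a
  proof -
    have "T 3 a 1 1 = partial a (\<lambda>x. - 1 * partial 2 (partial 2 (\<lambda>y. u y $ 3)) x) x"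
      unfolding T_def by (rule partial_cong[OF assms(1,4)]) (simp add: C(7))
    also have "\<dots> = - 1 * T 3 a 2 2"
      unfolding T_def
      by (rule partial_cmult[OF smooth_on_differentiable[OF smooth_on_partial[OF smooth_on_partial[OF smooth]] assms(4)]])
    finally show ?thesis by simp
  qed
  have e: "partial a (partial b (strain u l m)) x = (T l a b m + T m a b l) / 2" for a b l m
    by (simp add: partial_partial_strain[OF assms(1,2,4)] T_def)
  have M: "(\<Sum>j\<in>UNIV. \<Sum>l\<in>UNIV. \<Sum>m\<in>UNIV. \<Sum>n\<in>UNIV. tetragonal_M i j l m n * ((T l j n m + T m j n l) / 2))
      - (\<Sum>j\<in>UNIV. \<Sum>k\<in>UNIV. \<Sum>l\<in>UNIV. \<Sum>m\<in>UNIV. tetragonal_M l m i j k * ((T l k j m + T m k j l) / 2)) = 0" for i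
  proof -
    have "equilibrium \<Omega> (\<lambda>_ _ _ _. 0, tetragonal_M, \<lambda>_ _ _ _ _ _. 0) u"
      using assms(3) tetragonal_M_in_class unfolding universal_for_def by blast
    from this[unfolded equilibrium_iff[OF assms(1,2)], rule_format, OF assms(4), of i]
    show ?thesis by (simp add: e)
  qed
  \<comment> \<open>The hyper-stress sum contains only the strain \<open>e\<^sub>1\<^sub>2\<close>,
    hence only \<open>u\<^sub>1\<close> and \<open>u\<^sub>2\<close>, and drops out. The stress sum
    leaves differences, while \<open>T3'\<close> makes the matching sums zero.\<close>
  have "T 3 2 1 1 - T 3 2 2 2 = 0" "T 3 1 1 1 - T 3 1 2 2 = 0"
    using M[of 1] M[of 2] unfolding sum_3
    by (simp_all only: T12_zero T3 perm mult_zero_right add_0_left add_0_right div_0)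
      (simp_all add: tetragonal_M_def)
  then have "T 3 2 1 1 = 0" "T 3 2 2 2 = 0" "T 3 1 1 1 = 0" "T 3 1 2 2 = 0"
    using T3'[of 1] T3'[of 2] by auto
  then have "\<forall>i a b c. T i a b c = 0"
    unfolding forall_3
    by (simp add: T12_zero T3 perm)
  then show ?thesis by (simp add: T_def)
qed

section \<open>Quadratic universal displacements\<close>

text \<open>The strain has constant first derivatives, so only \<open>C\<close> contributes. The
  equations for \<open>i = 1\<close> and \<open>i = 2\<close> vanish term by term by parity; the
  third needs the two cancellations expressed by \<open>q2\<close> and the last part of
  \<open>q3\<close>.\<close>

lemma quadratic_universal:
  assumes "open \<Omega>" "displacement_field \<Omega> u"
    and q: "\<And>i j k x. x \<in> \<Omega> \<Longrightarrow> partial j (partial k (\<lambda>y. u y $ i)) x = q i j k"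
    and sym: "\<And>i j k. q i j k = q i k j"
    and q12: "\<And>i j k. (j, k) \<notin> {(2, 3), (1, 3), (3, 2), (3, 1)} \<Longrightarrow> q 1 j k = 0 \<and> q 2 j k = 0"
    and q2: "q 2 2 3 = - q 1 1 3"
    and q3: "q 3 1 3 = 0" "q 3 2 3 = 0" "q 3 3 3 = 0" "q 3 1 1 = - q 3 2 2"
  shows "universal_for \<Omega> tetragonal_D4_class u"
  unfolding universal_for_def
proof
  fix P assume "P \<in> tetragonal_D4_class"
  moreover obtain C M A where P: "P = (C, M, A)"
    by (cases P)
  ultimately have inv: "invariant4 D4_Z2c C"
    and symC: "C i j l m = C j i l m" "C i j l m = C l m i j" for i j l m
    unfolding tetragonal_D4_class_def strain_gradient_materials_def mem_Collect_eq case_prod_conv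
    by blast+
  have C: "C i j k l = s i * s j * s k * s l * C (p i) (p j) (p k) (p l)"
    if ex: "\<exists>Q\<in>D4_Z2c. tetragonal_matrix p s Q" for p s i j k l
  proof -
    obtain Q where Q: "Q \<in> D4_Z2c" "tetragonal_matrix p s Q"
      using ex by blast
    from inv[unfolded invariant4_def, rule_format, OF Q(1), of i j k l] show ?thesis
      unfolding invariant4_tetragonal[OF Q(2)] by (rule HOL.sym)
  qed
  have e: "partial j (strain u l m) x = (q l j m + q m j l) / 2" if "x \<in> \<Omega>" for j l m x
    using that by (simp add: partial_strain[OF assms(2)] q)
  have ee: "partial k (partial j (strain u l m)) x = 0" if "x \<in> \<Omega>" for k j l m x
    using partial_cong[OF assms(1) that e, where i=k] by simp
  have eee: "partial n (partial k (partial j (strain u l m))) x = 0" if "x \<in> \<Omega>" for n k j l m x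
    using partial_cong[OF assms(1) that ee, where i=n] by simp
  have odd: "C i j k l = 0"
    if "\<exists>Q\<in>D4_Z2c. tetragonal_matrix id s Q" "s i * s j * s k * s l = - 1" for s i j k l
    using C[OF that(1), of i j k l] that(2) by simp
  \<comment> \<open>A half turn about an axis annihilates the components in which that axis occurs
    an odd number of times.\<close>
  note odd1 = odd[OF D4_Z2c_members(2)] and odd3 = odd[OF D4_Z2c_members(3)]
  \<comment> \<open>The quarter turn exchanges 1 and 2; its negative sign enters twice and
    cancels.\<close>
  have Csym: "C 3 3 2 2 = C 3 3 1 1" "C 3 2 2 3 = C 3 1 1 3" "C 3 2 3 2 = C 3 1 3 1"
    using C[OF D4_Z2c_members(1), of 3 3 1 1] C[OF D4_Z2c_members(1), of 3 1 1 3]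
      C[OF D4_Z2c_members(1), of 3 1 3 1] by simp_all
  have C313: "C 3 1 1 3 = C 3 1 3 1"
    using symC by metis
  have q0: "q 1 1 1 = 0" "q 1 1 2 = 0" "q 1 2 1 = 0" "q 1 2 2 = 0" "q 1 3 3 = 0"
    "q 2 1 1 = 0" "q 2 1 2 = 0" "q 2 2 1 = 0" "q 2 2 2 = 0" "q 2 3 3 = 0"
    using q12 by simp_all
  have q3': "q 3 3 1 = 0" "q 3 3 2 = 0"
    using q3 sym by metis+
  have sym': "q i 3 2 = q i 2 3" "q i 3 1 = q i 1 3" "q 3 2 1 = q 3 1 2" for i
    using sym by blast+
  have C0:
    "C 1 1 1 3 = 0" "C 1 1 3 1 = 0" "C 1 3 1 1 = 0" "C 1 1 2 3 = 0" "C 1 1 3 2 = 0" "C 1 2 1 3 = 0"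
    "C 1 2 3 1 = 0" "C 1 3 1 2 = 0" "C 1 3 2 1 = 0" "C 1 2 2 3 = 0" "C 1 2 3 2 = 0" "C 1 3 2 2 = 0"
    "C 2 1 1 3 = 0" "C 2 1 3 1 = 0" "C 2 3 1 1 = 0" "C 2 1 2 3 = 0" "C 2 1 3 2 = 0" "C 2 2 1 3 = 0"
    "C 2 2 3 1 = 0" "C 2 3 1 2 = 0" "C 2 3 2 1 = 0" "C 2 2 2 3 = 0" "C 2 2 3 2 = 0" "C 2 3 2 2 = 0"
    by (rule odd3, simp)+
  have C1: "C 3 1 2 3 = 0" "C 3 1 3 2 = 0" "C 3 2 1 3 = 0" "C 3 2 3 1 = 0" "C 3 3 1 2 = 0" "C 3 3 2 1 = 0"
    by (rule odd1, simp)+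
  note zeros = q0 q3 q3' C0 C1 mult_zero_left mult_zero_right add_0_left add_0_right div_0
  have "(\<Sum>j\<in>UNIV. \<Sum>l\<in>UNIV. \<Sum>m\<in>UNIV. C i j l m * ((q l j m + q m j l) / 2)) = 0" for i
  proof -
    have "(\<Sum>j\<in>UNIV. \<Sum>l\<in>UNIV. \<Sum>m\<in>UNIV. C 1 j l m * ((q l j m + q m j l) / 2)) = 0"
      "(\<Sum>j\<in>UNIV. \<Sum>l\<in>UNIV. \<Sum>m\<in>UNIV. C 2 j l m * ((q l j m + q m j l) / 2)) = 0"
      unfolding sum_3 by (simp_all only: zeros)
    \<comment> \<open>The remaining terms are multiples of \<open>q 1 1 3 + q 2 2 3\<close> and
      \<open>q 3 1 1 + q 3 2 2\<close>, both zero.\<close>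
    moreover have "(\<Sum>j\<in>UNIV. \<Sum>l\<in>UNIV. \<Sum>m\<in>UNIV. C 3 j l m * ((q l j m + q m j l) / 2)) = 0"
      unfolding sum_3 by (simp only: zeros sym' q2 Csym C313) (simp add: algebra_simps)
    ultimately show ?thesis using exhaust_3[of i] by blast
  qed
  then show "equilibrium \<Omega> P u"
    unfolding P equilibrium_iff[OF assms(1,2)] by (simp add: e ee eee)
qed

section \<open>Classification of the universal displacements\<close>

theorem proposition3p20:
  fixes \<Omega> :: "(real^3) set" and u :: "real^3 \<Rightarrow> real^3"
  assumes "\<Omega> \<noteq> {}" and "convex \<Omega>" and "open \<Omega>"
    and "displacement_field \<Omega> u"
  shows "universal_for \<Omega> tetragonal_D4_class u \<longleftrightarrow>
    (\<exists>v w. homogeneous_on \<Omega> v \<and>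
       (\<exists>(c1::real) c2 c3 d1 d2 d3 d4 d5.
          \<forall>x\<in>\<Omega>. w x = vector
            [c1 * x$2 * x$3 + c2 * x$1 * x$3,
             - c2 * x$2 * x$3 + c3 * x$1 * x$3,
             d1 + d2 * x$1 + d3 * x$2 + d4 * x$1 * x$2 + d5 * ((x$2)\<^sup>2 - (x$1)\<^sup>2)]) \<and>
       (\<forall>x\<in>\<Omega>. u x = v x + w x))"
  (is "_ \<longleftrightarrow> ?form")
proof
  assume universal: "universal_for \<Omega> tetragonal_D4_class u"
  define P where "P i b h q \<longleftrightarrow> (\<forall>k l. q k l = q l k) \<and>
      (\<forall>x\<in>\<Omega>. \<forall>k l. partial k (partial l (\<lambda>y. u y $ i)) x = q k l) \<and>
      (\<forall>y\<in>\<Omega>. u y $ i = b + h \<bullet> y + (\<Sum>k\<in>UNIV. \<Sum>l\<in>UNIV. q k l * y$k * y$l) / 2)"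
    for i b and h :: "real^3" and q
  have "\<exists>b h q. P i b h q" for i
    unfolding P_def
    using assms(4) universal_third_partials_zero[OF assms(3,4) universal]
    by (intro quadratic_if_third_partials_zero[OF assms(3,2,1)]) (simp_all add: displacement_field_def)
  then obtain b h q where P: "\<And>i. P i (b i) (h i) (q i)"
    by metis
  have sym: "q i k l = q i l k"
    and q: "x \<in> \<Omega> \<Longrightarrow> partial k (partial l (\<lambda>y. u y $ i)) x = q i k l"
    and u: "x \<in> \<Omega> \<Longrightarrow> u x $ i = b i + h i \<bullet> x + (\<Sum>k\<in>UNIV. \<Sum>l\<in>UNIV. q i k l * x$k * x$l) / 2"
    for i k l x
    using P[of i] unfolding P_def by blast+
  \<comment> \<open>The second derivatives are constant, so one point suffices to read off their
    relations.\<close>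
  obtain z where z: "z \<in> \<Omega>" using assms(1) by blast
  note C = universal_second_partials[OF assms(3,4) universal z, unfolded q[OF z]]
  have q0: "q 1 1 1 = 0" "q 1 1 2 = 0" "q 1 2 2 = 0" "q 1 3 3 = 0"
    "q 2 1 1 = 0" "q 2 1 2 = 0" "q 2 2 2 = 0" "q 2 3 3 = 0"
    using C(1,2) by simp_all
  have sym': "q i 2 1 = q i 1 2" "q i 3 1 = q i 1 3" "q i 3 2 = q i 2 3" for i
    using sym by blast+
  define v :: "real^3 \<Rightarrow> real^3" where "v x = (\<chi> i. h i) *v x + (\<chi> i. b i)" for x
  \<comment> \<open>The coefficients are the surviving second derivatives. The affine part is
    already in \<open>v\<close>, so \<open>d1\<close>, \<open>d2\<close> and \<open>d3\<close> are
    0; they are written out so that \<open>w_def\<close> matches the required form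
    literally.\<close>
  define w :: "real^3 \<Rightarrow> real^3" where "w x = vector
      [q 1 2 3 * x$2 * x$3 + q 1 1 3 * x$1 * x$3,
       - q 1 1 3 * x$2 * x$3 + q 2 1 3 * x$1 * x$3,
       0 + 0 * x$1 + 0 * x$2 + q 3 1 2 * x$1 * x$2 + (q 3 2 2 / 2) * ((x$2)\<^sup>2 - (x$1)\<^sup>2)]" for x
  have v: "homogeneous_on \<Omega> v"
    unfolding homogeneous_on_def v_def by blast
  have uvw: "u x = v x + w x" if "x \<in> \<Omega>" for x
  proof -
    have "v x $ i = b i + h i \<bullet> x" for i
      by (simp add: v_def matrix_vector_mult_def inner_vec_def)
    then have "\<forall>i. u x $ i = v x $ i + w x $ i"
      unfolding forall_3 u[OF that] sum_3 w_def vector_3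
      by (simp only: q0 sym' C(3-7)) (simp add: field_simps power2_eq_square)
    then show ?thesis by (simp add: vec_eq_iff)
  qed
  show ?form
    by (intro exI[of _ v] exI[of _ w] conjI ballI v uvw, intro exI ballI, rule w_def)
next
  assume ?form
  then obtain v w c1 c2 c3 d1 d2 d3 d4 d5 where "homogeneous_on \<Omega> v" and
    w: "\<And>x. x \<in> \<Omega> \<Longrightarrow> w x = vector
      [c1 * x$2 * x$3 + c2 * x$1 * x$3,
       - c2 * x$2 * x$3 + c3 * x$1 * x$3,
       d1 + d2 * x$1 + d3 * x$2 + d4 * x$1 * x$2 + d5 * ((x$2)\<^sup>2 - (x$1)\<^sup>2)]" and
    u: "\<And>x. x \<in> \<Omega> \<Longrightarrow> u x = v x + w x"
    by blast
  then obtain H :: "real^3^3" and b where v: "\<And>x. x \<in> \<Omega> \<Longrightarrow> v x = H *v x + b"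
    unfolding homogeneous_on_def by blast
  \<comment> \<open>The Hessians of the components: the first branch covers pairs with exactly one
    index 3, the second the in-plane Hessian of \<open>g\<close>.\<close>
  define q :: "3 \<Rightarrow> 3 \<Rightarrow> 3 \<Rightarrow> real" where "q i k l =
    (if k = 3 \<and> l \<noteq> 3 \<or> k \<noteq> 3 \<and> l = 3 then
       (if i = 3 then 0 else if k = 2 \<or> l = 2 then (if i = 1 then c1 else - c2) else (if i = 1 then c2 else c3))
     else if i = 3 \<and> k \<noteq> 3 then
       (if k \<noteq> l then d4 else if k = 1 then - 2 * d5 else 2 * d5)
     else 0)" for i k l
  have sym: "q i k l = q i l k" for i k l
    unfolding q_def by auto
  \<comment> \<open>The affine terms of \<open>g\<close> join those of the homogeneous field in the
    third component.\<close>
  have u_quadratic: "u x $ i = (b $ i + (if i = 3 then d1 else 0)) + (H $ i + (if i = 3 then vector [d2, d3, 0] else 0)) \<bullet> x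
      + (\<Sum>k\<in>UNIV. \<Sum>l\<in>UNIV. q i k l * x$k * x$l) / 2" if "x \<in> \<Omega>" for x i
  proof -
    have "\<forall>i. u x $ i = (b $ i + (if i = 3 then d1 else 0)) + (H $ i + (if i = 3 then vector [d2, d3, 0] else 0)) \<bullet> x
      + (\<Sum>k\<in>UNIV. \<Sum>l\<in>UNIV. q i k l * x$k * x$l) / 2"
      unfolding forall_3 u[OF that] v[OF that] w[OF that] sum_3 q_def
      by (simp add: matrix_vector_mult_def inner_vec_def sum_3 field_simps power2_eq_square)
    then show ?thesis by blast
  qed
  have q: "partial j (partial k (\<lambda>y. u y $ i)) x = q i j k" if "x \<in> \<Omega>" for i j k x
    using partial_partial_quadratic[OF assms(3) that sym u_quadratic, where i=k and j=j] by (simp add: sym)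
  show "universal_for \<Omega> tetragonal_D4_class u"
  proof (rule quadratic_universal[OF assms(3,4) q sym])
    show "q 1 j k = 0 \<and> q 2 j k = 0" if "(j, k) \<notin> {(2, 3), (1, 3), (3, 2), (3, 1)}" for j k
      using that exhaust_3[of j] exhaust_3[of k] by (auto simp: q_def)
  qed (simp_all add: q_def)
qed

end
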